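(* Let $W$ be an equitant elliptic family of bisectors such that the real plane cubic $E_W$ is irreducible, and let $B\subset B_W$ be an infinite subset of its base. Then $$W=\big\{h\in \mathrm{Lin}_{\mathbb C}(V,V)\ \big|\ h^*=h,\ \langle hb,b\rangle=0\text{ for all }b\in B\big\}.$$
   Context: $V$ is a 3-dimensional $\mathbb C$-linear space with a hermitian form $\langle-,-\rangle$ (linear in the first argument) of signature $++-$; the same letter denotes a point of $\mathbb P_{\mathbb C}V$ and a representative in $V$. $\mathbb B=\{p\in\mathbb P_{\mathbb C}V\mid\langle p,p\rangle<0\}$. $\mathrm{Lin}_{\mathbb C}(V,V)$ is the space of $\mathbb C$-linear maps $V\to V$, $h^*$ is the adjoint of $h$ with respect to $\langle-,-\rangle$, and $\langle-,v\rangle w$ denotes the map $x\mapsto\langle x,v\rangle w$. A family of bisectors is an $\mathbb R$-linear subspace $W\subset\mathrm{Lin}_{\mathbb C}(V,V)$ such that $\operatorname{tr}h=0$ and $h^*=h$ for all $h\in W$, $W$ is the $\mathbb R$-span of $D_W:=\{h\in W\mid\det h=0\}$, and $B_W\cap\mathbb B\ne\varnothing$, where $B_W:=\{p\in\mathbb P_{\mathbb C}V\mid\langle hp,p\rangle=0\text{ for all }h\in W\}$ is the base of the family. $E_W\subset\mathbb P_{\mathbb R}W$ is given by the equation $\det=0$. The family is elliptic if $\dim_{\mathbb R}W=3$ and $D_W\ne W$; then $E_W$ is a real plane cubic, and irreducible means that the cubic form $\det|_W$ is irreducible. Equitant families: let $p_1,\dots,p_4\in\mathbb P_{\mathbb C}V$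 be points of a same signature $\sigma\in\{+1,-1,0\}$ (the sign of $\langle p_i,p_i\rangle$), no 3 of them on a same complex projective line. Choose representatives $p_i\in V$ with $\langle p_i,p_i\rangle=\sigma$ and suppose that there is $p\in V$ with $\langle p,p\rangle<0$ and $|\langle p,p_i\rangle|=1$ for all $i$. Put $w_i:=\langle-,p_i\rangle p_i$. Then $W:=\{\sum_{i=1}^4r_iw_i\mid r_i\in\mathbb R,\ \sum_{i=1}^4r_i=0\}$ is an elliptic family of bisectors, called equitant from the $p_i$'s. An elliptic family is equitant if it arises in this way. *)

theory Defs
  imports
    "HOL-Analysis.Analysis"
    "HOL-Computational_Algebra.Computational_Algebra"
    "HOL-Library.Function_Algebras"
begin

text \<open>
  The signature assumption is the existence of an orthogonal basis with Gram matrix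
  \<open>diag(1, 1, -1)\<close>; such vectors are automatically independent, hence a basis in dimension 3.
\<close>

locale hermitian_space = vector_space scale
  for scale :: "complex \<Rightarrow> 'v::ab_group_add \<Rightarrow> 'v" +
  fixes form :: "'v \<Rightarrow> 'v \<Rightarrow> complex"
  assumes dim_UNIV: "dim UNIV = 3"
    and form_add_left: "form (x + y) z = form x z + form y z"
    and form_scale_left: "form (scale c x) z = c * form x z"
    and form_commute: "form y x = cnj (form x y)"
    and signature: "\<exists>e1 e2 e3. form e1 e1 = 1 \<and> form e2 e2 = 1 \<and> form e3 e3 = - 1 \<and>
                      form e1 e2 = 0 \<and> form e1 e3 = 0 \<and> form e2 e3 = 0"
begin

text \<open>The complex linear endomorphisms, and the real scaling making them a real vector space
  (addition is the pointwise one).\<close>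

definition Lin :: "('v \<Rightarrow> 'v) set" where
  "Lin = {h. Vector_Spaces.linear scale scale h}"

definition rscale :: "real \<Rightarrow> ('v \<Rightarrow> 'v) \<Rightarrow> ('v \<Rightarrow> 'v)" where
  "rscale r h = (\<lambda>v. scale (complex_of_real r) (h v))"

sublocale lin: vector_space rscale
  by unfold_locales (auto simp: rscale_def fun_eq_iff scale_right_distrib scale_left_distrib)

definition adj :: "('v \<Rightarrow> 'v) \<Rightarrow> ('v \<Rightarrow> 'v)" where
  "adj h = (THE g. g \<in> Lin \<and> (\<forall>x y. form (h x) y = form x (g y)))"

definition frame :: "(3 \<Rightarrow> 'v) \<Rightarrow> bool" where
  "frame e \<longleftrightarrow> inj e \<and> independent (range e) \<and> span (range e) = UNIV"

definition lin_matrix :: "(3 \<Rightarrow> 'v) \<Rightarrow> ('v \<Rightarrow> 'v) \<Rightarrow> complex ^ 3 ^ 3" where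
  "lin_matrix e h = (\<chi> i j. representation (range e) (h (e j)) (e i))"

text \<open>Trace and determinant of an endomorphism do not depend on the chosen basis.\<close>

definition lin_trace :: "('v \<Rightarrow> 'v) \<Rightarrow> complex" where
  "lin_trace h = trace (lin_matrix (SOME e. frame e) h)"

definition lin_det :: "('v \<Rightarrow> 'v) \<Rightarrow> complex" where
  "lin_det h = det (lin_matrix (SOME e. frame e) h)"

text \<open>Points of the complex projective plane are the one-dimensional subspaces.\<close>

definition points :: "'v set set" where
  "points = {span {v} | v. v \<noteq> 0}"

definition neg_points :: "'v set set" where
  "neg_points = {P \<in> points. \<forall>v\<in>P - {0}. Re (form v v) < 0}"

definition base :: "('v \<Rightarrow> 'v) set \<Rightarrow> 'v set set" where
  "base W = {P \<in> points. \<forall>h\<in>W. \<forall>v\<in>P. form (h v) v = 0}"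

definition det_zero :: "('v \<Rightarrow> 'v) set \<Rightarrow> ('v \<Rightarrow> 'v) set" where
  "det_zero W = {h \<in> W. lin_det h = 0}"

definition bisector_family :: "('v \<Rightarrow> 'v) set \<Rightarrow> bool" where
  "bisector_family W \<longleftrightarrow>
     W \<subseteq> Lin \<and> lin.subspace W \<and>
     (\<forall>h\<in>W. lin_trace h = 0 \<and> adj h = h) \<and>
     lin.span (det_zero W) = W \<and>
     base W \<inter> neg_points \<noteq> {}"

definition elliptic_family :: "('v \<Rightarrow> 'v) set \<Rightarrow> bool" where
  "elliptic_family W \<longleftrightarrow> bisector_family W \<and> lin.dim W = 3 \<and> det_zero W \<noteq> W"

definition rank_one :: "'v \<Rightarrow> ('v \<Rightarrow> 'v)" where
  "rank_one p = (\<lambda>x. scale (form x p) p)"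

definition equitant_family :: "('v \<Rightarrow> 'v) set \<Rightarrow> bool" where
  "equitant_family W \<longleftrightarrow> elliptic_family W \<and>
     (\<exists>(p :: nat \<Rightarrow> 'v) (\<sigma> :: real).
        \<sigma> \<in> {1, -1, 0} \<and>
        (\<forall>i\<in>{1..4}. p i \<noteq> 0 \<and> form (p i) (p i) = complex_of_real \<sigma>) \<and>
        (\<forall>i\<in>{1..4}. \<forall>j\<in>{1..4}. \<forall>k\<in>{1..4}. i \<noteq> j \<and> i \<noteq> k \<and> j \<noteq> k \<longrightarrow>
           \<not> (\<exists>L. subspace L \<and> dim L = 2 \<and> p i \<in> L \<and> p j \<in> L \<and> p k \<in> L)) \<and>
        (\<exists>q. Re (form q q) < 0 \<and> (\<forall>i\<in>{1..4}. cmod (form q (p i)) = 1)) \<and>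
        W = {\<Sum>i=1..4. rscale (r i) (rank_one (p i)) | r :: nat \<Rightarrow> real. (\<Sum>i=1..4. r i) = 0})"

text \<open>
  Real polynomials in three variables are the iterated univariate ones. In coordinates with
  respect to a real basis of \<open>W\<close>, the restriction of the determinant to \<open>W\<close> is a
  (unique, homogeneous of degree 3) polynomial \<open>F\<close>; its irreducibility does not depend on the basis.
\<close>

definition irreducible_cubic :: "('v \<Rightarrow> 'v) set \<Rightarrow> bool" where
  "irreducible_cubic W \<longleftrightarrow>
     (\<exists>h1 h2 h3. \<exists>F :: real poly poly poly.
        distinct [h1, h2, h3] \<and> lin.independent {h1, h2, h3} \<and> lin.span {h1, h2, h3} = W \<and>
        (\<forall>x y z. lin_det (rscale x h1 + rscale y h2 + rscale z h3) =
                   complex_of_real (poly (poly (poly F [:[:x:]:]) [:y:]) z)) \<and>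
        irreducible F)"

end

end

theory Submission
  imports Defs "HOL-Computational_Algebra.Field_as_Ring"
begin

text \<open>
  Rescaling the \<open>p\<^sub>i\<close> by phases gives \<open>p\<^sub>4 = a p\<^sub>1 + b p\<^sub>2 + c p\<^sub>3\<close> with \<open>a, b, c > 0\<close>.
  Then the base is the curve \<open>\<bar>a + b u + c v\<bar> = 1\<close> on the torus \<open>\<bar>u\<bar> = \<bar>v\<bar> = 1\<close>, that is, the zero
  set of \<open>G = (a + b u + c v) (a u v + b v + c u) - u v\<close>, and every hermitian form restricts to the
  torus as a polynomial \<open>H\<close> whose Newton polygon lies in that of \<open>G\<close>. Up to a diagonal change of
  coordinates and a constant factor, \<open>G\<close> is also the dehomogenised determinant cubic of the family.
  It is irreducible over the complex numbers unless one of \<open>a, b, c\<close> is 1 and the other two are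
  equal, and in that case the determinant splits off a real line. So, for an irreducible cubic,
  infinitely many common zeros of \<open>G\<close> and \<open>H\<close> force \<open>H = k G\<close> with \<open>k\<close> real, which says that the
  hermitian form belongs to the family.
\<close>

section \<open>Common zeros of bivariate polynomials\<close>

text \<open>A weak form of Bezout: if \<open>G\<close> did not divide \<open>H\<close>, some nonzero
  polynomial in \<open>u\<close> alone would vanish on \<open>Z\<close>, leaving finitely many
  values of \<open>u\<close>, while primality of \<open>G\<close> keeps every fibre over
  \<open>u\<close> finite.\<close>

lemma prime_dvd_if_infinite_zeros:
  fixes G H :: "'a::field poly poly"
  assumes G: "prime_elem G" and deg: "degree G > 0" and inf: "infinite Z"
    and ZG: "\<And>u v. (u, v) \<in> Z \<Longrightarrow> poly (poly G [:v:]) u = 0"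
    and ZH: "\<And>u v. (u, v) \<in> Z \<Longrightarrow> poly (poly H [:v:]) u = 0"
  shows "G dvd H"
proof (rule ccontr)
  assume "\<not> G dvd H"
  \<comment> \<open>A counterexample of minimal degree in \<open>v\<close> is a polynomial in \<open>u\<close> alone, by pseudo-division.\<close>
  define S where "S = {P. \<not> G dvd P \<and> (\<forall>u v. (u, v) \<in> Z \<longrightarrow> poly (poly P [:v:]) u = 0)}"
  have "H \<in> S" using \<open>\<not> G dvd H\<close> ZH by (auto simp: S_def)
  then obtain P where P: "P \<in> S" and min: "\<And>Q. Q \<in> S \<Longrightarrow> degree P \<le> degree Q"
    using ex_has_least_nat[of "\<lambda>P. P \<in> S" H degree] by blast
  have [simp]: "G \<noteq> 0" using G by auto
  have nP: "\<not> G dvd P" and ZP: "\<And>u v. (u, v) \<in> Z \<Longrightarrow> poly (poly P [:v:]) u = 0"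
    using P by (auto simp: S_def)
  have [simp]: "P \<noteq> 0" using nP by auto
  have dvd: "G dvd R" if "degree R < degree P" "\<And>u v. (u, v) \<in> Z \<Longrightarrow> poly (poly R [:v:]) u = 0" for R
    using that min[of R] by (force simp: S_def)
  have const: "\<not> G dvd [:\<beta>:]" if "\<beta> \<noteq> 0" for \<beta>
    using deg that dvd_imp_degree_le[of G "[:\<beta>:]"] by auto
  \<comment> \<open>Otherwise the pseudo-remainder of \<open>P\<close> by \<open>G\<close> has
    smaller degree than \<open>P\<close>, hence is a multiple of \<open>G\<close>, and primality
    makes \<open>G\<close> divide \<open>P\<close>.\<close>
  have PG: "degree P \<le> degree G"
  proof (rule ccontr)
    assume less: "\<not> degree P \<le> degree G"
    obtain \<beta> q where q: "\<beta> \<noteq> 0" "smult \<beta> P = G * q + pseudo_mod P G"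
      using pseudo_mod(1)[of G P] by auto
    have "pseudo_mod P G = [:\<beta>:] * P - G * q" using q(2) by simp
    moreover have "degree (pseudo_mod P G) < degree P"
      using pseudo_mod(2)[of G P] less deg by auto
    ultimately have "G dvd pseudo_mod P G" by (intro dvd) (auto simp: ZG ZP)
    then have "G dvd [:\<beta>:] * P" using q by simp
    then show False using prime_elem_dvd_multD[OF G] const[OF q(1)] nP by blast
  qed
  \<comment> \<open>Division the other way leaves a multiple of \<open>G\<close> of lower degree,
    hence 0. Then \<open>G\<close> divides \<open>q\<close>, and cancelling \<open>G\<close> shows
    that \<open>P\<close> divides \<open>[:\<alpha>:]\<close>, which is free of
    \<open>v\<close>.\<close>
  obtain \<alpha> q where q: "\<alpha> \<noteq> 0" "smult \<alpha> G = P * q + pseudo_mod G P"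
    using pseudo_mod(1)[of P G] by auto
  have R: "pseudo_mod G P = [:\<alpha>:] * G - P * q" using q(2) by simp
  have "G dvd pseudo_mod G P"
  proof (cases "pseudo_mod G P = 0")
    case False
    then have "degree (pseudo_mod G P) < degree P"
      using pseudo_mod(2)[of P G] by auto
    then show ?thesis by (rule dvd) (auto simp: ZG ZP R)
  qed simp
  then have "pseudo_mod G P = 0"
    using pseudo_mod(2)[of P G] PG deg dvd_imp_degree_le[of G "pseudo_mod G P"] by fastforce
  then have eq: "[:\<alpha>:] * G = P * q" using R by simp
  then have "G dvd P * q" by (metis dvd_triv_right)
  then have "G dvd q" using prime_elem_dvd_multD[OF G] nP by blast
  then obtain q' where "q = G * q'" ..
  then have "[:\<alpha>:] * G = (P * q') * G" using eq by (simp add: mult.assoc mult.commute mult.left_commute)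
  then have "[:\<alpha>:] = P * q'" using \<open>G \<noteq> 0\<close> by (metis mult_cancel_right)
  then have "P dvd [:\<alpha>:]" by simp
  then have "degree P = 0" using dvd_imp_degree_le[of P "[:\<alpha>:]"] q(1) by simp
  then obtain p where p: "P = [:p:]" by (rule degree_eq_zeroE)
  have "p \<noteq> 0" using \<open>P \<noteq> 0\<close> p by auto
  then have fin: "finite {u. poly p u = 0}" by (rule poly_roots_finite)
  \<comment> \<open>An infinite fibre makes all coefficients of \<open>G\<close> vanish at
    \<open>u\<close>, so the nonunit \<open>[:[:- u, 1:]:]\<close> splits off, which a prime of
    positive degree in \<open>v\<close> does not allow.\<close>
  have fibre: "finite {v. (u, v) \<in> Z}" for u
  proof (rule ccontr)
    assume inf: "infinite {v. (u, v) \<in> Z}"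
    define g where "g = map_poly (\<lambda>p. poly p u) G"
    have g: "poly (poly G [:v:]) u = poly g v" for v
      unfolding g_def by (induction G) (simp_all add: map_poly_pCons)
    then have "{v. (u, v) \<in> Z} \<subseteq> {v. poly g v = 0}" using ZG by (auto simp flip: g)
    then have "g = 0" using inf poly_roots_finite finite_subset by blast
    then have "poly (coeff G n) u = 0" for n
      unfolding g_def by (metis coeff_0 coeff_map_poly poly_0)
    then have "[:[:- u, 1:]:] dvd G" by (simp add: const_poly_dvd_iff poly_eq_0_iff_dvd)
    then obtain G' where G': "G = [:[:- u, 1:]:] * G'" ..
    have "G dvd [:[:- u, 1:]:] * G'" using G' by simp
    then have "G dvd G'" using prime_elem_dvd_multD[OF G] const[of "[:- u, 1:]"] by fastforce
    then obtain t where "G' = G * t" ..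
    then have "G * 1 = G * ([:[:- u, 1:]:] * t)" using G' by (simp add: mult.left_commute)
    then have "1 = [:[:- u, 1:]:] * t" using \<open>G \<noteq> 0\<close> mult_cancel_left by blast
    then have "[:[:- u, 1:]:] dvd (1 :: 'a poly poly)" by (metis dvd_triv_left)
    then show False by (simp add: is_unit_pCons_iff is_unit_poly_iff) 
  qed
  have "Z \<subseteq> (SIGMA u:{u. poly p u = 0}. {v. (u, v) \<in> Z})"
    using ZP by (auto simp: p)
  then have "finite Z" by (rule finite_subset) (intro finite_SigmaI fin fibre)
  then show False using inf by contradiction
qed

section \<open>Irreducibility of the base curve over the complex numbers\<close>

lemma complex_nonunit_poly_root:
  fixes p :: "complex poly"
  assumes "p \<noteq> 0" "\<not> p dvd 1"
  obtains z where "poly p z = 0"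
  using assms fundamental_theorem_of_algebra[of p]
  by (auto simp: constant_degree is_unit_iff_degree)

text \<open>The two equations say that \<open>v + p\<close> divides the quadratic \<open>base_poly a b c\<close> defined below.\<close>

lemma no_root_section:
  fixes a b c :: real and p q :: "complex poly"
  assumes pos: "a > 0" "b > 0" "c > 0"
    and nex: "\<not> (a = 1 \<and> b = c)" "\<not> (b = 1 \<and> a = c)"
    and C: "p * q = [:0, of_real (c * a), of_real (c * b):]"
    and B: "p * [:of_real (c * b), of_real (c * a):] + q =
            [:of_real (a * b), of_real (a\<^sup>2 + b\<^sup>2 + c\<^sup>2 - 1), of_real (a * b):]"
  shows False
proof -
  let ?A = "[:complex_of_real (c * b), of_real (c * a):]"
  let ?B = "[:complex_of_real (a * b), of_real (a\<^sup>2 + b\<^sup>2 + c\<^sup>2 - 1), of_real (a * b):]"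
  have [simp]: "c \<noteq> 0" using pos by simp
  have nz: "p \<noteq> 0" "q \<noteq> 0" using C pos by auto
  have "degree (p * q) = 2" unfolding C using pos by simp
  then have dpq: "degree p + degree q = 2" using nz by (simp add: degree_mult_eq)
  \<comment> \<open>A quadratic \<open>p\<close> leaves \<open>q\<close> constant, so the left side
    of \<open>B\<close> would be cubic and the right side quadratic.\<close>
  have "degree p \<noteq> 2"
  proof
    assume 2: "degree p = 2"
    have "degree (p * ?A) = 3" using 2 nz pos by (subst degree_mult_eq) auto
    then have "degree (p * ?A + q) = 3" using 2 dpq by (subst degree_add_eq_left) auto
    then show False unfolding B using pos by simp
  qed
  then have "degree p \<le> 1" using dpq by linarith
  then obtain x y where p: "p = [:x, y:]"
    by (cases p rule: pCons_cases, rename_tac x p', case_tac p' rule: pCons_cases) (auto split: if_splits)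
  \<comment> \<open>Eliminate \<open>q\<close> and compare coefficients in \<open>C\<close>: the
    extreme ones, \<open>e0\<close> and \<open>e3\<close>, leave two values each for
    \<open>x\<close> and \<open>y\<close>.\<close>
  have q: "q = ?B - p * ?A" using B by (simp add: algebra_simps)
  have e0: "x * (a * b - c * b * x) = 0"
    and e1: "x * (a\<^sup>2 + b\<^sup>2 + c\<^sup>2 - 1 - c * (a * x + b * y)) + y * (a * b - c * b * x) = c * a"
    and e2: "x * (a * b - c * a * y) + y * (a\<^sup>2 + b\<^sup>2 + c\<^sup>2 - 1 - c * (a * x + b * y)) = c * b"
    and e3: "y * (a * b - c * a * y) = 0"
    using C unfolding q p by (simp_all add: algebra_simps)
  have x: "x = 0 \<or> x = of_real (a / c)" using e0 pos by (auto simp: field_simps)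
  have y: "y = 0 \<or> y = of_real (b / c)" using e3 pos by (auto simp: field_simps)
  \<comment> \<open>The mixed cases yield exactly the two excluded parameter sets. In the first case
    \<open>e1\<close> reads \<open>0 = c a\<close>; in the last it reduces to
    \<open>c\<^sup>2 - 1 = c\<^sup>2\<close>.\<close>
  consider "x = 0" "y = 0" | "x = 0" "y = of_real (b / c)" | "x = of_real (a / c)" "y = 0"
    | "x = of_real (a / c)" "y = of_real (b / c)" using x y by blast
  then show False
  proof cases
    case 1
    then show ?thesis using e1 pos by simp
  next
    case 2
    have "complex_of_real (b / c * (a * b)) = of_real (c * a)" using e1 2 by simp
    then have "b / c * (a * b) = c * a" by (simp only: of_real_eq_iff)
    then have bc: "b\<^sup>2 = c\<^sup>2" using pos by (simp add: field_simps power2_eq_square)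
    then have bc': "b = c" using pos by (simp add: power2_eq_iff)
    have "complex_of_real (b / c * (a\<^sup>2 + b\<^sup>2 + c\<^sup>2 - 1 - c * (b * (b / c)))) = of_real (c * b)"
      using e2 2 by simp
    then have "b / c * (a\<^sup>2 + b\<^sup>2 + c\<^sup>2 - 1 - c * (b * (b / c))) = c * b"
      by (simp only: of_real_eq_iff)
    then have "a\<^sup>2 = 1" using pos bc' by (simp add: field_simps power2_eq_square)
    then show ?thesis using pos bc' nex by (simp add: power2_eq_1_iff)
  next
    case 3
    have "complex_of_real (a / c * (a * b)) = of_real (c * b)" using e2 3 by simp
    then have "a / c * (a * b) = c * b" by (simp only: of_real_eq_iff)
    then have bc: "a\<^sup>2 = c\<^sup>2" using pos by (simp add: field_simps power2_eq_square)
    then have bc': "a = c" using pos by (simp add: power2_eq_iff)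
    have "complex_of_real (a / c * (a\<^sup>2 + b\<^sup>2 + c\<^sup>2 - 1 - c * (a * (a / c)))) = of_real (c * a)"
      using e1 3 by simp
    then have "a / c * (a\<^sup>2 + b\<^sup>2 + c\<^sup>2 - 1 - c * (a * (a / c))) = c * a"
      by (simp only: of_real_eq_iff)
    then have "b\<^sup>2 = 1" using pos bc' by (simp add: field_simps power2_eq_square)
    then show ?thesis using pos bc' nex by (simp add: power2_eq_1_iff)
  next
    case 4
    have "complex_of_real (a / c * (a\<^sup>2 + b\<^sup>2 + c\<^sup>2 - 1 - c * (a * (a / c) + b * (b / c)))
        + b / c * (a * b - c * b * (a / c))) = of_real (c * a)"
      using e1 4 by simp
    then have "a / c * (a\<^sup>2 + b\<^sup>2 + c\<^sup>2 - 1 - c * (a * (a / c) + b * (b / c)))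
        + b / c * (a * b - c * b * (a / c)) = c * a"
      by (simp only: of_real_eq_iff)
    then show ?thesis using pos by (simp add: field_simps power2_eq_square)
  qed
qed

text \<open>\<open>(a + b u + c v) (a u v + b v + c u) - u v\<close>, as a polynomial in \<open>v\<close> over the polynomials
  in \<open>u\<close>: the equation \<open>\<bar>a + b u + c v\<bar>\<^sup>2 = 1\<close> on the torus, multiplied by \<open>u v\<close>.\<close>

definition base_poly :: "real \<Rightarrow> real \<Rightarrow> real \<Rightarrow> complex poly poly" where
  "base_poly a b c =
    [:[:0, of_real (c * a), of_real (c * b):],
      [:of_real (a * b), of_real (a\<^sup>2 + b\<^sup>2 + c\<^sup>2 - 1), of_real (a * b):],
      [:of_real (c * b), of_real (c * a):]:]"

text \<open>A factor in \<open>u\<close> alone has a root common to all three coefficients, which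
  forces \<open>c = 1\<close> and \<open>a = b\<close>. In a product of two factors linear in
  \<open>v\<close>, one leading coefficient is constant because \<open>?A\<close> has degree 1 in
  \<open>u\<close>; after scaling, that factor is \<open>v + p\<close>, excluded by
  \<open>no_root_section\<close>.\<close>

lemma base_poly_irreducible:
  assumes pos: "a > 0" "b > 0" "c > 0"
    and nex: "\<not> (a = 1 \<and> b = c)" "\<not> (b = 1 \<and> a = c)" "\<not> (c = 1 \<and> a = b)"
  shows "irreducible (base_poly a b c)"
proof -
  let ?A = "[:complex_of_real (c * b), of_real (c * a):]"
  let ?B = "[:complex_of_real (a * b), of_real (a\<^sup>2 + b\<^sup>2 + c\<^sup>2 - 1), of_real (a * b):]"
  let ?C = "[:0, complex_of_real (c * a), of_real (c * b):]"
  have G: "base_poly a b c = [:?C, ?B, ?A:]" by (simp add: base_poly_def)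
  have deg: "degree (base_poly a b c) = 2" unfolding G using pos by simp
  have no_linear: False
    if "p0 * q0 = ?C" "p0 * q1 + p1 * q0 = ?B" "p1 * q1 = ?A" and d0: "degree p1 = 0" for p0 p1 q0 q1
  proof -
    obtain k where k: "p1 = [:k:]" using degree_eq_zeroE d0 by blast
    have [simp]: "k \<noteq> 0" using k that(3) pos by auto
    \<comment> \<open>Dividing one factor by \<open>k\<close> and multiplying the other by it makes
      the first one monic in \<open>v\<close>.\<close>
    have "smult (1 / k) p0 * ?A = p0 * q1" unfolding that(3)[symmetric] k by simp
    then show False
      using no_root_section[OF pos nex(1,2), of "smult (1 / k) p0" "smult k q0"] that(1,2)
      by (simp add: k)
  qed
  have const: "P dvd 1" if PQ: "base_poly a b c = P * Q" and P0: "degree P = 0" for P Q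
  proof (rule ccontr)
    assume "\<not> P dvd 1"
    obtain p where p: "P = [:p:]" using degree_eq_zeroE P0 by blast
    have "[:p:] dvd [:?C, ?B, ?A:]" using PQ unfolding G p by (metis dvd_triv_left)
    then have "p dvd coeff [:?C, ?B, ?A:] n" for n by (simp only: const_poly_dvd_iff)
    from this[of 0] this[of 1] this[of 2] have dvd: "p dvd ?C" "p dvd ?B" "p dvd ?A"
      by (simp_all add: numeral_2_eq_2)
    have "\<not> p dvd 1" using \<open>\<not> P dvd 1\<close> p by (simp add: is_unit_const_poly_iff)
    moreover have "p \<noteq> 0" using dvd(3) pos by auto
    ultimately obtain z where z: "poly p z = 0" using complex_nonunit_poly_root by blast
    \<comment> \<open>The common root is \<open>z = - b / a\<close> by \<open>?A\<close>; then
      \<open>?C\<close> gives \<open>a = b\<close>, so \<open>z = - 1\<close>, and \<open>?B\<close>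
      gives \<open>c = 1\<close>.\<close>
    have "poly r z = 0" if "p dvd r" for r using that z by (auto elim!: dvdE)
    then have C: "poly ?C z = 0" and B: "poly ?B z = 0" and A: "poly ?A z = 0"
      using dvd by blast+
    have "of_real c * (of_real a * z + of_real b) = 0" using A by (simp add: algebra_simps)
    then have "of_real a * z + of_real b = 0" using pos by simp
    then have "of_real a * z = - of_real b" by (simp only: eq_neg_iff_add_eq_0)
    then have zz: "z = of_real (- b / a)" using pos by (simp add: field_simps)
    have "complex_of_real (c * a + c * b * (- b / a)) = 0" using C pos unfolding zz by simp
    then have "c * a + c * b * (- b / a) = 0" by (simp only: of_real_eq_0_iff)
    then have "a\<^sup>2 = b\<^sup>2" using pos by (simp add: field_simps power2_eq_square)
    then have ab: "a = b" using pos by (simp add: power2_eq_iff)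
    have "complex_of_real (2 * a\<^sup>2 - (2 * a\<^sup>2 + c\<^sup>2 - 1)) = 0"
      using B pos unfolding zz ab by (simp add: power2_eq_square)
    then have "2 * a\<^sup>2 - (2 * a\<^sup>2 + c\<^sup>2 - 1) = 0" by (simp only: of_real_eq_0_iff)
    then show False using nex pos ab by (simp add: power2_eq_1_iff)
  qed
  show ?thesis
  proof (rule irreducibleI)
    show "base_poly a b c \<noteq> 0" using deg by auto
    show "\<not> base_poly a b c dvd 1" using deg by (auto simp: is_unit_poly_iff)
    fix P Q assume PQ: "base_poly a b c = P * Q"
    have "P \<noteq> 0" "Q \<noteq> 0" using PQ deg by auto
    then have "degree P + degree Q = 2" using deg PQ by (simp add: degree_mult_eq)
    then consider "degree P = 0" | "degree Q = 0" | "degree P = 1" "degree Q = 1" by linarith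
    then show "P dvd 1 \<or> Q dvd 1"
    proof cases
      case 1
      then show ?thesis using const PQ by blast
    next
      case 2
      then show ?thesis using const[of Q P] PQ by (simp add: mult.commute)
    next
      case 3
      obtain p0 p1 where P: "P = [:p0, p1:]" using degree1_coeffs[OF 3(1)] by blast
      obtain q0 q1 where Q: "Q = [:q0, q1:]" using degree1_coeffs[OF 3(2)] by blast
      have e: "p0 * q0 = ?C" "p0 * q1 + p1 * q0 = ?B" "p1 * q1 = ?A"
        using PQ unfolding G P Q by simp_all
      have "degree (p1 * q1) = 1" unfolding e(3) using pos by simp
      moreover have "p1 \<noteq> 0" "q1 \<noteq> 0" using e(3) pos by auto
      ultimately have "degree p1 + degree q1 = 1" by (simp add: degree_mult_eq)
      then consider "degree p1 = 0" | "degree q1 = 0" by linarith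
      then have False
      proof cases
        case 1
        then show ?thesis by (rule no_linear[OF e])
      next
        case 2
        have "q0 * p0 = ?C" "q0 * p1 + q1 * p0 = ?B" "q1 * p1 = ?A"
          using e by (simp_all add: mult.commute add.commute)
        then show ?thesis using 2 by (rule no_linear)
      qed
      then show ?thesis ..
    qed
  qed
qed

text \<open>The equation in \<open>H\<close> is a hermitian form on the vector
  \<open>(1, u, v)\<close> of the torus, multiplied by \<open>u v\<close>; of the diagonal only the
  sum \<open>d\<close> survives. Divisibility by the irreducible \<open>base_poly\<close> and
  equality of degrees in \<open>v\<close> and in \<open>u\<close> leave a constant quotient.\<close>

lemma hermitian_form_multiple:
  fixes a b c :: real and d h12 h13 h23 :: complex and Z :: "(complex \<times> complex) set"
  assumes pos: "a > 0" "b > 0" "c > 0"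
    and nex: "\<not> (a = 1 \<and> b = c)" "\<not> (b = 1 \<and> a = c)" "\<not> (c = 1 \<and> a = b)"
    and inf: "infinite Z"
    and Z: "\<And>(u :: complex) (v :: complex). (u, v) \<in> Z \<Longrightarrow> (a + b * u + c * v) * (a * u * v + b * v + c * u) = u * v"
    and H: "\<And>u v. (u, v) \<in> Z \<Longrightarrow>
              d * u * v + cnj h12 * u\<^sup>2 * v + h12 * v + cnj h13 * u * v\<^sup>2 + h13 * u
              + h23 * u\<^sup>2 + cnj h23 * v\<^sup>2 = 0"
  obtains k :: real where "h12 = k * a * b" "h13 = k * a * c" "h23 = k * b * c"
    "d = k * (a\<^sup>2 + b\<^sup>2 + c\<^sup>2 - 1)"
proof -
  define Hp where "Hp = [:[:0, h13, h23:], [:h12, d, cnj h12:], [:cnj h23, cnj h13:]:]"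
  have dG: "degree (base_poly a b c) = 2" using pos by (simp add: base_poly_def)
  have prime: "prime_elem (base_poly a b c)"
    by (intro irreducible_imp_prime_elem base_poly_irreducible pos nex)
  have "base_poly a b c dvd Hp"
  proof (rule prime_dvd_if_infinite_zeros[OF prime _ inf])
    show "poly (poly (base_poly a b c) [:v:]) u = 0" if "(u, v) \<in> Z" for u v
      using Z[OF that] by (simp add: base_poly_def power2_eq_square algebra_simps)
    show "poly (poly Hp [:v:]) u = 0" if "(u, v) \<in> Z" for u v
      using H[OF that] by (simp add: Hp_def power2_eq_square algebra_simps)
  qed (simp add: dG)
  then obtain K where K: "Hp = base_poly a b c * K" ..
  have "degree K = 0"
  proof (cases "K = 0")
    case False
    have "degree Hp \<le> 2" by (simp add: Hp_def)
    moreover have "degree Hp = 2 + degree K"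
      unfolding K using False dG by (subst degree_mult_eq) auto
    ultimately show ?thesis by simp
  qed simp
  then obtain q where q: "K = [:q:]" by (rule degree_eq_zeroE)
  \<comment> \<open>Treating the conjugate coefficient as a separate unknown gives two equations
    with the same right-hand side; their agreement later makes \<open>k\<close> real.\<close>
  obtain g where g: "g = cnj h12" by simp
  have e0: "[:0, h13, h23:] = q * [:0, of_real (c * a), of_real (c * b):]"
    and e1: "[:h12, d, g:] =
           q * [:of_real (a * b), of_real (a\<^sup>2 + b\<^sup>2 + c\<^sup>2 - 1), of_real (a * b):]"
    and e2: "[:cnj h23, cnj h13:] = q * [:of_real (c * b), of_real (c * a):]"
    using K unfolding q Hp_def base_poly_def g by (simp_all add: mult.commute)
  have "degree q = 0"
  proof (cases "q = 0")
    case False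
    have "degree (q * [:complex_of_real (c * b), of_real (c * a):]) = degree q + 1"
      using False pos by (subst degree_mult_eq) auto
    then show ?thesis unfolding e2[symmetric] by (simp split: if_splits)
  qed simp
  then obtain k where k: "q = [:k:]" by (rule degree_eq_zeroE)
  have h: "h12 = k * a * b" "g = k * a * b" "h13 = k * a * c" "h23 = k * b * c"
    "d = k * (a\<^sup>2 + b\<^sup>2 + c\<^sup>2 - 1)"
    using e0 e1 unfolding k by (simp_all add: mult_ac)
  have "cnj (k * a * b) = k * a * b" using h(2) unfolding g h(1) .
  then have "cnj k = k" using pos by simp
  then have "k = of_real (Re k)" by (simp add: complex_eq_iff)
  then show thesis using h that[of "Re k"] by simp
qed

section \<open>Factorisation of real ternary cubics\<close>

text \<open>The order of the variables is that of \<open>irreducible_cubic\<close>.\<close>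

definition eval3 :: "real poly poly poly \<Rightarrow> real \<Rightarrow> real \<Rightarrow> real \<Rightarrow> real" where
  "eval3 F x y z = poly (poly (poly F [:[:x:]:]) [:y:]) z"

lemma eval3_simps [simp]:
  "eval3 (F + G) x y z = eval3 F x y z + eval3 G x y z"
  "eval3 (F * G) x y z = eval3 F x y z * eval3 G x y z"
  "eval3 1 x y z = 1"
  by (simp_all add: eval3_def)

lemma poly_ext_on_infinite:
  fixes p q :: "'a::idom poly"
  assumes "infinite S" "\<And>x. x \<in> S \<Longrightarrow> poly p x = poly q x"
  shows "p = q"
proof (rule ccontr)
  assume "p \<noteq> q"
  then have "finite {x. poly (p - q) x = 0}" by (intro poly_roots_finite) simp
  then show False using assms finite_subset[of S "{x. poly (p - q) x = 0}"] by auto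
qed

text \<open>The one-variable identity theorem is applied three times, from the outermost variable
  inwards, with the embedded real constants as infinite set of arguments.\<close>

lemma eval3_ext:
  assumes "\<And>x y z. eval3 F x y z = eval3 G x y z"
  shows "F = G"
proof (rule poly_ext_on_infinite)
  have "inj (\<lambda>x::real. [:[:x:]:])" by (auto intro: injI)
  then show "infinite (range (\<lambda>x::real. [:[:x:]:]))"
    using finite_imageD infinite_UNIV_char_0 by blast
  fix p :: "real poly poly" assume "p \<in> range (\<lambda>x::real. [:[:x:]:])"
  then obtain x where p: "p = [:[:x:]:]" by blast
  show "poly F p = poly G p"
  proof (rule poly_ext_on_infinite)
    have "inj (\<lambda>x::real. [:x:])" by (auto intro: injI)
    then show "infinite (range (\<lambda>x::real. [:x:]))"
      using finite_imageD infinite_UNIV_char_0 by blast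
    fix q :: "real poly" assume "q \<in> range (\<lambda>x::real. [:x:])"
    then obtain y where q: "q = [:y:]" by blast
    show "poly (poly F p) q = poly (poly G p) q"
      using assms[of x y] by (intro poly_ext_on_infinite[OF infinite_UNIV_char_0]) (simp add: eval3_def p q)
  qed
qed

text \<open>Vanishing at the origin certifies that a factor is not a unit, which avoids any degree
  count in the iterated polynomial ring.\<close>

lemma not_irreducible_if_eval3_factors:
  assumes F: "\<And>x y z. eval3 F x y z = eval3 P x y z * eval3 Q x y z"
    and 0: "eval3 P 0 0 0 = 0" "eval3 Q 0 0 0 = 0"
  shows "\<not> irreducible F"
proof
  assume "irreducible F"
  moreover have "F = P * Q" by (rule eval3_ext) (simp add: F)
  ultimately have "P dvd 1 \<or> Q dvd 1" by (rule irreducibleD)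
  moreover have "\<not> R dvd 1" if "eval3 R 0 0 0 = 0" for R
  proof
    assume "R dvd 1"
    then obtain S where "1 = R * S" ..
    then have "eval3 1 0 0 0 = eval3 R 0 0 0 * eval3 S 0 0 0" by (metis eval3_simps(2))
    then show False using that by simp
  qed
  ultimately show False using 0 by blast
qed

lemma eval3_linear: "\<exists>P. \<forall>x y z. eval3 P x y z = l * x + m * y + n * z"
  by (rule exI[of _ "[:[:[:0, n:], [:m:]:], [:[:l:]:]:]"]) (simp add: eval3_def algebra_simps)

lemma eval3_const: "\<exists>P. \<forall>x y z. eval3 P x y z = k"
  by (rule exI[of _ "[:[:[:k:]:]:]"]) (simp add: eval3_def)

text \<open>For \<open>A = 1\<close> and \<open>B = C = D\<close> the cubic equals
  \<open>- (r2 + r3) * (r2 * r3 + D * r1 * (r1 + r2 + r3))\<close> up to \<open>K\<close>. The other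
  cases follow by permuting the \<open>r\<close>'s together with \<open>A\<close>, \<open>B\<close>,
  \<open>C\<close>.\<close>

lemma degenerate_cubic_not_irreducible:
  fixes A B C K :: real and r1 r2 r3 :: "real \<Rightarrow> real \<Rightarrow> real \<Rightarrow> real"
  assumes lin: "\<And>r. r \<in> {r1, r2, r3} \<Longrightarrow> \<exists>l m n. \<forall>x y z. r x y z = l * x + m * y + n * z"
    and F: "\<And>x y z. eval3 F x y z = K * (r1 x y z * r2 x y z * r3 x y z
              - (r1 x y z + r2 x y z + r3 x y z)
                * (C * r1 x y z * r2 x y z + B * r1 x y z * r3 x y z + A * r2 x y z * r3 x y z))"
    and deg: "A = 1 \<and> B = C \<or> B = 1 \<and> A = C \<or> C = 1 \<and> A = B"
  shows "\<not> irreducible F"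
proof -
  have *: "\<not> irreducible F"
    if lin: "\<And>r. r \<in> {s1, s2, s3} \<Longrightarrow> \<exists>l m n. \<forall>x y z. r x y z = l * x + m * y + n * z"
      and F: "\<And>x y z. eval3 F x y z = K * (s2 x y z + s3 x y z)
          * (- (s2 x y z * s3 x y z + D * s1 x y z * (s1 x y z + s2 x y z + s3 x y z)))"
    for s1 s2 s3 and D
  proof -
    have "\<exists>P. \<forall>x y z. eval3 P x y z = r x y z" if "r \<in> {s1, s2, s3}" for r
      using lin[OF that] eval3_linear by metis
    then obtain S1 S2 S3 where S: "\<And>x y z. eval3 S1 x y z = s1 x y z"
      "\<And>x y z. eval3 S2 x y z = s2 x y z" "\<And>x y z. eval3 S3 x y z = s3 x y z"
      by (metis insertCI)
    obtain KP where KP: "\<And>x y z. eval3 KP x y z = K" using eval3_const by metis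
    obtain DP where DP: "\<And>x y z. eval3 DP x y z = D" using eval3_const by metis
    obtain MP where MP: "\<And>x y z. eval3 MP x y z = - 1" using eval3_const by metis
    have 0: "r 0 0 0 = 0" if "r \<in> {s1, s2, s3}" for r using lin[OF that] by auto
    show ?thesis
      by (rule not_irreducible_if_eval3_factors
            [where P = "KP * (S2 + S3)" and Q = "MP * (S2 * S3 + DP * S1 * (S1 + S2 + S3))"])
        (simp_all add: S KP DP MP F 0)
  qed
  from deg consider "A = 1" "B = C" | "B = 1" "A = C" | "C = 1" "A = B" by blast
  then show ?thesis
  proof cases
    case 1
    show ?thesis by (rule *[of r1 r2 r3 B]) (use lin in blast, simp add: F 1 algebra_simps)
  next
    case 2
    show ?thesis by (rule *[of r2 r1 r3 A]) (use lin in blast, simp add: F 2 algebra_simps)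
  next
    case 3
    show ?thesis by (rule *[of r3 r1 r2 A]) (use lin in blast, simp add: F 3 algebra_simps)
  qed
qed

section \<open>Dual frames of a hermitian space\<close>

definition vec3 :: "'a \<Rightarrow> 'a \<Rightarrow> 'a \<Rightarrow> 3 \<Rightarrow> 'a" where
  "vec3 x y z = (\<lambda>i. if i = 1 then x else if i = 2 then y else z)"

lemma vec3_simps [simp]: "vec3 x y z 1 = x" "vec3 x y z 2 = y" "vec3 x y z 3 = z"
  by (simp_all add: vec3_def)

context hermitian_space
begin

lemma form_zero_left [simp]: "form 0 z = 0"
  using form_scale_left[of 0 0 z] by simp

lemma form_minus_left [simp]: "form (- x) z = - form x z"
  using form_scale_left[of "-1" x z] by simp

lemma form_diff_left: "form (x - y) z = form x z - form y z"
  using form_add_left[of x "- y" z] by simp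

lemma form_sum_left: "form (sum f A) z = (\<Sum>i\<in>A. form (f i) z)"
  by (induction A rule: infinite_finite_induct) (simp_all add: form_add_left)

lemma form_add_right: "form x (y + z) = form x y + form x z"
  by (metis form_commute form_add_left complex_cnj_add)

lemma form_scale_right: "form x (scale c y) = cnj c * form x y"
  by (metis form_commute form_scale_left complex_cnj_mult)

lemma form_zero_right [simp]: "form x 0 = 0"
  using form_scale_right[of x 0 0] by simp

lemma form_minus_right [simp]: "form x (- y) = - form x y"
  using form_scale_right[of x "-1" y] by simp

lemma form_sum_right: "form x (sum f A) = (\<Sum>i\<in>A. form x (f i))"
  by (induction A rule: infinite_finite_induct) (simp_all add: form_add_right)

lemma finite_basis_exists:
  obtains Bas where "finite_dimensional_vector_space scale Bas" "card Bas = 3"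
proof -
  obtain Bas where "independent Bas" "UNIV \<subseteq> span Bas" "card Bas = dim UNIV"
    by (rule basis_exists[of UNIV])
  moreover from this have "finite Bas" using dim_UNIV by (simp add: card_ge_0_finite)
  ultimately show thesis
    using dim_UNIV by (intro that) (unfold_locales, auto)
qed

lemma frameI:
  assumes "inj e" "independent (range e)"
  shows "frame e"
proof -
  obtain Bas where "finite_dimensional_vector_space scale Bas" by (rule finite_basis_exists)
  then interpret fd: finite_dimensional_vector_space scale Bas .
  have "card (range e) = 3" using card_image[OF assms(1)] by simp
  then have "UNIV \<subseteq> span (range e)"
    using assms(2) dim_UNIV by (intro fd.card_ge_dim_independent) auto
  then show ?thesis using assms by (auto simp: frame_def)
qed

lemma frame_expand:
  assumes "frame e"
  obtains c where "x = (\<Sum>i\<in>UNIV. scale (c i) (e i))"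
proof -
  have "x \<in> span (range e)" using assms by (simp add: frame_def)
  then obtain u where "x = (\<Sum>v\<in>range e. scale (u v) v)"
    by (auto simp: span_finite)
  also have "\<dots> = (\<Sum>i\<in>UNIV. scale (u (e i)) (e i))"
    using assms by (simp add: frame_def sum.reindex)
  finally show thesis by (rule that)
qed

text \<open>With biorthogonal systems, \<open>form x (p i)\<close> is the coordinate of
  \<open>x\<close> along \<open>q i\<close>, so all coordinates are read off by the form
  itself.\<close>

definition dual_frames :: "(3 \<Rightarrow> 'v) \<Rightarrow> (3 \<Rightarrow> 'v) \<Rightarrow> bool" where
  "dual_frames q p \<longleftrightarrow> (\<forall>i j. form (q i) (p j) = (if i = j then 1 else 0))"

lemma dual_frames_sym: "dual_frames q p \<Longrightarrow> dual_frames p q"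
  unfolding dual_frames_def by (metis form_commute complex_cnj_one complex_cnj_zero)

lemma dual_frames_coeff:
  assumes "dual_frames q p"
  shows "form (\<Sum>i\<in>UNIV. scale (c i) (q i)) (p j) = c j"
proof -
  have "form (\<Sum>i\<in>UNIV. scale (c i) (q i)) (p j) = (\<Sum>i\<in>UNIV. if i = j then c i else 0)"
    unfolding form_sum_left using assms
    by (intro sum.cong) (auto simp: dual_frames_def form_scale_left)
  then show ?thesis by simp
qed

lemma dual_frames_imp_frame:
  assumes "dual_frames q p"
  shows "frame q"
proof (rule frameI)
  show inj: "inj q"
    using assms unfolding dual_frames_def inj_def by (metis zero_neq_one)
  show "independent (range q)"
  proof
    assume "dependent (range q)"
    then obtain u i where u: "u (q i) \<noteq> 0" "(\<Sum>v\<in>range q. scale (u v) v) = 0"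
      by (auto simp: dependent_finite)
    have "u (q i) = form (\<Sum>j\<in>UNIV. scale (u (q j)) (q j)) (p i)"
      using dual_frames_coeff[OF assms, of "u \<circ> q"] by simp
    also have "\<dots> = 0" using u(2) inj by (simp add: sum.reindex)
    finally show False using u(1) by simp
  qed
qed

lemma dual_frames_expand:
  assumes "dual_frames q p"
  shows "x = (\<Sum>i\<in>UNIV. scale (form x (p i)) (q i))"
proof -
  obtain c where c: "x = (\<Sum>i\<in>UNIV. scale (c i) (q i))"
    by (rule frame_expand[OF dual_frames_imp_frame[OF assms]])
  then have "form x (p i) = c i" for i by (simp add: dual_frames_coeff[OF assms])
  then show ?thesis using c by simp
qed

lemma dual_frames_exist: "\<exists>e e'. dual_frames e e'"
proof -
  obtain e1 e2 e3 where "form e1 e1 = 1" "form e2 e2 = 1" "form e3 e3 = - 1"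
    "form e1 e2 = 0" "form e1 e3 = 0" "form e2 e3 = 0"
    using signature by blast
  \<comment> \<open>The sign on the last vector compensates \<open>form e3 e3 = - 1\<close>.\<close>
  then have "dual_frames (vec3 e1 e2 e3) (vec3 e1 e2 (- e3))"
    unfolding dual_frames_def
    by (simp add: forall_3 form_commute[of e1 e2] form_commute[of e1 e3] form_commute[of e2 e3])
  then show ?thesis by blast
qed

lemma form_nondegenerate: "(\<And>y. form x y = 0) \<Longrightarrow> x = 0"
  using dual_frames_exist dual_frames_expand[of _ _ x] by fastforce

lemma form_eqI: "(\<And>y. form x y = form x' y) \<Longrightarrow> x = x'"
  using form_nondegenerate[of "x - x'"] by (simp add: form_diff_left)

lemma frame_form_eq_0:
  assumes "frame p" "\<And>i. form x (p i) = 0"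
  shows "x = 0"
proof (rule form_nondegenerate)
  fix y
  obtain c where "y = (\<Sum>i\<in>UNIV. scale (c i) (p i))" by (rule frame_expand[OF assms(1)])
  then show "form x y = 0" by (simp add: form_sum_right form_scale_right assms(2))
qed

text \<open>Sending \<open>x\<close> to the vector with coordinates \<open>form x (p i)\<close> is
  injective by nondegeneracy, hence surjective; the preimages of a fixed basis form the dual
  frame.\<close>

lemma dual_frame_exists:
  assumes "frame p"
  obtains q where "dual_frames q p"
proof -
  obtain e e' where e: "dual_frames e e'" using dual_frames_exist by blast
  obtain Bas where "finite_dimensional_vector_space scale Bas" by (rule finite_basis_exists)
  then interpret fd: finite_dimensional_vector_space scale Bas .
  define T where "T x = (\<Sum>i\<in>UNIV. scale (form x (p i)) (e i))" for x
  have T: "form (T x) (e' i) = form x (p i)" for x i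
    unfolding T_def by (rule dual_frames_coeff[OF e])
  have "Vector_Spaces.linear scale scale T"
    by unfold_locales (simp_all add: T_def form_add_left form_scale_left scale_left_distrib
        sum.distrib scale_sum_right)
  moreover have "inj T"
  proof (rule injI)
    fix x y assume "T x = T y"
    then have "form (x - y) (p i) = 0" for i using T by (metis form_diff_left right_minus_eq)
    then show "x = y" using frame_form_eq_0[OF assms] by fastforce
  qed
  ultimately have "surj T" by (rule fd.linear_inj_imp_surj)
  then have "\<forall>i. \<exists>x. T x = e i" by (metis surjD)
  then obtain q where "\<And>i. T (q i) = e i" by metis
  then have "dual_frames q p" using e T unfolding dual_frames_def by metis
  then show thesis by (rule that)
qed

text \<open>If the three vectors spanned less than the whole space, a basis of their span could be
  enlarged to a two-element independent set, whose span is a forbidden plane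
  \<open>L\<close>.\<close>

lemma frame_if_not_collinear:
  assumes "\<not> (\<exists>L. subspace L \<and> dim L = 2 \<and> x \<in> L \<and> y \<in> L \<and> z \<in> L)"
  shows "frame (vec3 x y z)"
proof -
  let ?S = "range (vec3 x y z)"
  have S: "?S = {x, y, z}" by (simp add: UNIV_3)
  obtain C where C: "C \<subseteq> ?S" "independent C" "?S \<subseteq> span C" by (rule basis_exists[of ?S])
  obtain B where B: "C \<subseteq> B" "independent B" "UNIV \<subseteq> span B"
    by (rule maximal_independent_subset_extend[OF subset_UNIV C(2)])
  have "card B = 3" using basis_card_eq_dim[OF subset_UNIV B(3,2)] dim_UNIV by simp
  have "\<not> card C \<le> 2"
  proof
    assume "card C \<le> 2"
    then obtain D where D: "C \<subseteq> D" "D \<subseteq> B" "card D = 2"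
      using exists_subset_between[of C 2 B] B(1) \<open>card B = 3\<close> by (auto simp: card_ge_0_finite)
    have "dim (span D) = 2"
      using D independent_mono[OF B(2)] by (simp add: dim_eq_card_independent)
    moreover have "?S \<subseteq> span D" using C(3) span_mono[OF D(1)] by (rule subset_trans)
    then have "x \<in> span D" "y \<in> span D" "z \<in> span D" unfolding S by simp_all
    ultimately show False using assms subspace_span[of D] by auto
  qed
  moreover have fin: "finite ?S" by simp
  moreover have "card ?S \<le> 3" using card_image_le[of UNIV "vec3 x y z"] by simp
  ultimately have "C = ?S" "card ?S = 3"
    using C(1) card_mono[OF fin C(1)] card_subset_eq[OF fin C(1)] by auto
  then show ?thesis
    using C(2) by (intro frameI) (auto intro: eq_card_imp_inj_on)
qed

section \<open>Linear maps and adjoints\<close>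

lemma Lin_add: "h \<in> Lin \<Longrightarrow> h (x + y) = h x + h y"
  and Lin_scale: "h \<in> Lin \<Longrightarrow> h (scale c x) = scale c (h x)"
  by (simp_all add: Lin_def linear_iff_module_hom module_hom.add module_hom.scale)

lemma Lin_sum: "h \<in> Lin \<Longrightarrow> h (sum f A) = (\<Sum>i\<in>A. h (f i))"
  by (simp add: Lin_def linear_iff_module_hom module_hom.sum)

text \<open>As \<open>adj\<close> is a definite description, the adjoint must be shown to exist, by
  an explicit formula in dual frames, and to be unique, by nondegeneracy.\<close>

lemma form_self_adjoint:
  assumes h: "h \<in> Lin" "adj h = h"
  shows "form (h x) y = form x (h y)"
proof -
  obtain e e' where e: "dual_frames e e'" using dual_frames_exist by blast
  define g where "g y = (\<Sum>i\<in>UNIV. scale (cnj (form (h (e i)) y)) (e' i))" for y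
  have g: "form (h x) y = form x (g y)" for x y
    by (subst dual_frames_expand[OF e, of x])
      (simp add: Lin_sum[OF h(1)] Lin_scale[OF h(1)] g_def form_sum_left form_sum_right
        form_scale_left form_scale_right mult.commute)
  have "Vector_Spaces.linear scale scale g"
    by unfold_locales (simp_all add: g_def form_add_right form_scale_right scale_left_distrib
        sum.distrib scale_sum_right)
  then have "g \<in> Lin" by (simp add: Lin_def)
  have "adj h = g"
    unfolding adj_def
  proof (rule the_equality)
    show "g \<in> Lin \<and> (\<forall>x y. form (h x) y = form x (g y))" using \<open>g \<in> Lin\<close> g by blast
    fix g' assume g': "g' \<in> Lin \<and> (\<forall>x y. form (h x) y = form x (g' y))"
    show "g' = g"
    proof
      fix y
      have "form x (g' y) = form x (g y)" for x using g g' by metis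
      then show "g' y = g y" by (intro form_eqI) (metis form_commute)
    qed
  qed
  then show ?thesis using g h(2) by simp
qed

section \<open>Equitant families\<close>

lemma rscale_apply: "rscale r h x = scale (complex_of_real r) (h x)"
  by (simp add: rscale_def)

lemma rank_one_apply: "rank_one p x = scale (form x p) p"
  by (simp add: rank_one_def)

lemma sum_fun_apply: "(\<Sum>i\<in>A. f i) x = (\<Sum>i\<in>A. f i x)" for f :: "'i \<Rightarrow> 'v \<Rightarrow> 'v"
  by (induction A rule: infinite_finite_induct) simp_all

text \<open>This lets the phases of the points be changed without changing the family.\<close>

lemma rank_one_scale:
  assumes "cmod c = 1"
  shows "rank_one (scale c p) = rank_one p"
proof
  have "cnj c * c = 1" using assms complex_norm_square[of c] by (simp add: mult.commute)
  then show "rank_one (scale c p) x = rank_one p x" for x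
    by (simp add: rank_one_apply form_scale_right mult.assoc mult.left_commute)
qed

text \<open>The general element \<open>r\<^sub>1 w\<^sub>1 + \<dots> + r\<^sub>4 w\<^sub>4\<close> of an equitant family, with \<open>r\<^sub>4\<close> eliminated by
  \<open>r\<^sub>1 + \<dots> + r\<^sub>4 = 0\<close> and \<open>p\<^sub>4\<close> written as the combination of the other three points with
  coefficients \<open>a\<close>.\<close>

definition equitant_comb :: "(3 \<Rightarrow> 'v) \<Rightarrow> (3 \<Rightarrow> real) \<Rightarrow> (3 \<Rightarrow> real) \<Rightarrow> 'v \<Rightarrow> 'v" where
  "equitant_comb p a r =
    (\<Sum>i\<in>UNIV. rscale (r i) (rank_one (p i)))
    - rscale (\<Sum>i\<in>UNIV. r i) (rank_one (\<Sum>i\<in>UNIV. scale (of_real (a i)) (p i)))"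

lemma form_equitant_comb:
  "form (equitant_comb p a r x) y =
    (\<Sum>i\<in>UNIV. of_real (r i) * form x (p i) * cnj (form y (p i)))
    - of_real (\<Sum>i\<in>UNIV. r i) * (\<Sum>i\<in>UNIV. of_real (a i) * form x (p i))
      * cnj (\<Sum>i\<in>UNIV. of_real (a i) * form y (p i))"
  by (simp add: equitant_comb_def sum_fun_apply rscale_apply rank_one_apply form_diff_left
      form_sum_left form_sum_right form_scale_left form_scale_right form_commute[symmetric] mult.assoc)

lemma equitant_comb_linear:
  "rscale x (equitant_comb p a r) + rscale y (equitant_comb p a s) + rscale z (equitant_comb p a t)
    = equitant_comb p a (\<lambda>i. x * r i + y * s i + z * t i)"
proof
  fix v
  show "(rscale x (equitant_comb p a r) + rscale y (equitant_comb p a s)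
      + rscale z (equitant_comb p a t)) v = equitant_comb p a (\<lambda>i. x * r i + y * s i + z * t i) v"
    by (rule form_eqI)
      (simp add: rscale_apply form_add_left form_scale_left form_equitant_comb sum_3 algebra_simps)
qed

text \<open>The map takes the numbers \<open>form x (p l)\<close>, applies a real matrix and
  recombines the \<open>p k\<close>. Only the middle factor, diagonal minus rank one, depends on
  \<open>r\<close>.\<close>

lemma lin_matrix_equitant_comb:
  assumes e: "frame e"
  shows "lin_matrix e (equitant_comb p a r) =
    (\<chi> i k. representation (range e) (p k) (e i))
    ** (\<chi> k l. of_real ((if k = l then r k else 0) - (\<Sum>i\<in>UNIV. r i) * a k * a l))
    ** (\<chi> l j. form (e j) (p l))"
proof -
  let ?R = "representation (range e)"
  have ind: "independent (range e)" and sp: "\<And>v. v \<in> span (range e)"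
    using e by (auto simp: frame_def)
  have R: "?R (u + v) b = ?R u b + ?R v b" "?R (u - v) b = ?R u b - ?R v b"
      "?R (scale c u) b = c * ?R u b" for u v b c
    by (simp_all add: representation_add representation_diff representation_scale ind sp)
  show ?thesis
    by (simp add: vec_eq_iff lin_matrix_def matrix_matrix_mult_def equitant_comb_def sum_3 forall_3
        rscale_apply rank_one_apply form_add_right form_scale_right R algebra_simps)
qed

text \<open>\<open>K\<close> is the product of the determinants of the two outer factors; the cubic
  is the determinant of the middle one.\<close>

lemma lin_det_equitant_comb:
  "\<exists>K. \<forall>r. lin_det (equitant_comb p a r) =
    K * of_real (r 1 * r 2 * r 3 - (r 1 + r 2 + r 3)
          * ((a 3)\<^sup>2 * r 1 * r 2 + (a 2)\<^sup>2 * r 1 * r 3 + (a 1)\<^sup>2 * r 2 * r 3))"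
proof -
  define e where "e = (SOME e. frame e)"
  have "\<exists>e. frame e" using dual_frames_exist dual_frames_imp_frame by blast
  then have e: "frame e" unfolding e_def by (rule someI_ex)
  define K where "K = det (\<chi> i k. representation (range e) (p k) (e i)) * det (\<chi> l j. form (e j) (p l))"
  have "lin_det (equitant_comb p a r) =
    K * of_real (r 1 * r 2 * r 3 - (r 1 + r 2 + r 3)
          * ((a 3)\<^sup>2 * r 1 * r 2 + (a 2)\<^sup>2 * r 1 * r 3 + (a 1)\<^sup>2 * r 2 * r 3))" for r
  proof -
    have "det (\<chi> k l. complex_of_real ((if k = l then r k else 0) - (\<Sum>i\<in>UNIV. r i) * a k * a l)) =
      of_real (r 1 * r 2 * r 3 - (r 1 + r 2 + r 3)
          * ((a 3)\<^sup>2 * r 1 * r 2 + (a 2)\<^sup>2 * r 1 * r 3 + (a 1)\<^sup>2 * r 2 * r 3))"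
      by (simp add: det_3 sum_3 power2_eq_square algebra_simps)
    then show ?thesis
      unfolding lin_det_def e_def[symmetric] lin_matrix_equitant_comb[OF e] det_mul K_def
      by (simp only: mult_ac)
  qed
  then show ?thesis by blast
qed

section \<open>Normal form of an equitant family and its determinant cubic\<close>

lemma sum_1_to_4: "(\<Sum>i=1..4. f i) = f 1 + f 2 + f 3 + f 4" for f :: "nat \<Rightarrow> 'b::comm_monoid_add"
proof -
  have "{1..4} = {1, 2, 3, 4::nat}" by auto
  then show ?thesis by (simp add: add.assoc)
qed

text \<open>All coordinates of the fourth point in the frame of the first three are nonzero, since
  no three points are collinear; their phases are absorbed into the frame, leaving positive
  coefficients.\<close>

lemma equitant_normal_form:
  assumes "equitant_family W"
  obtains q p a where "dual_frames q p" "\<And>i. a i > 0" "W = range (equitant_comb p a)"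
proof -
  obtain P :: "nat \<Rightarrow> 'v" where
    coll: "\<And>i j k. i \<in> {1..4} \<Longrightarrow> j \<in> {1..4} \<Longrightarrow> k \<in> {1..4} \<Longrightarrow> i \<noteq> j \<and> i \<noteq> k \<and> j \<noteq> k \<Longrightarrow>
       \<not> (\<exists>L. subspace L \<and> dim L = 2 \<and> P i \<in> L \<and> P j \<in> L \<and> P k \<in> L)"
    and W: "W = {\<Sum>i=1..4. rscale (r i) (rank_one (P i)) | r :: nat \<Rightarrow> real. (\<Sum>i=1..4. r i) = 0}"
    using assms unfolding equitant_family_def by blast
  have fr: "frame (vec3 (P i) (P j) (P k))"
    if "i \<in> {1..4}" "j \<in> {1..4}" "k \<in> {1..4}" "i \<noteq> j \<and> i \<noteq> k \<and> j \<noteq> k" for i j k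
    by (rule frame_if_not_collinear[OF coll[OF that]])
  define p where "p = vec3 (P 1) (P 2) (P 3)"
  obtain q where q: "dual_frames q p"
    using dual_frame_exists fr[of 1 2 3] unfolding p_def by auto
  define g where "g i = form (P 4) (q i)" for i
  have P4: "P 4 = (\<Sum>i\<in>UNIV. scale (g i) (p i))"
    unfolding g_def by (rule dual_frames_expand[OF dual_frames_sym[OF q]])
  have pq: "form (q i) (p j) = (if i = j then 1 else 0)" for i j
    using q by (simp add: dual_frames_def)
  have qP: "form (q i) (P 1) = (if i = 1 then 1 else 0)" "form (q i) (P 2) = (if i = 2 then 1 else 0)"
    "form (q i) (P 3) = (if i = 3 then 1 else 0)" for i
    using pq[of i 1] pq[of i 2] pq[of i 3] by (simp_all add: p_def)
  have q0: "q i \<noteq> 0" for i using pq[of i i] by auto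
  \<comment> \<open>Otherwise \<open>q i\<close> is orthogonal to \<open>P 4\<close> and to the two
    points of \<open>p\<close> other than \<open>p i\<close>, which together form a frame.\<close>
  have "form (q i) (P 4) \<noteq> 0" for i
  proof
    assume 0: "form (q i) (P 4) = 0"
    have *: False if "frame (vec3 x y z)" "form (q i) x = 0" "form (q i) y = 0" "form (q i) z = 0" for x y z
    proof -
      have "form (q i) (vec3 x y z j) = 0" for j using that(2-4) by (simp add: vec3_def)
      then have "q i = 0" by (rule frame_form_eq_0[OF that(1)])
      then show False using q0 by blast
    qed
    consider "i = 1" | "i = 2" | "i = 3" using exhaust_3 by blast
    then show False
    proof cases
      case 1
      show ?thesis by (rule *[OF fr[of 2 3 4]]) (use 0 in \<open>simp_all add: 1 qP del: One_nat_def\<close>)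
    next
      case 2
      show ?thesis by (rule *[OF fr[of 1 3 4]]) (use 0 in \<open>simp_all add: 2 qP del: One_nat_def\<close>)
    next
      case 3
      show ?thesis by (rule *[OF fr[of 1 2 4]]) (use 0 in \<open>simp_all add: 3 qP del: One_nat_def\<close>)
    qed
  qed
  then have g0: "g i \<noteq> 0" for i unfolding g_def by (metis form_commute complex_cnj_zero)
  define a where "a i = cmod (g i)" for i
  define t where "t i = g i / of_real (a i)" for i
  have a: "a i > 0" for i using g0 by (simp add: a_def)
  have t: "cmod (t i) = 1" for i using a[of i] by (simp add: t_def norm_divide) (simp add: a_def)
  define p' where "p' i = scale (t i) (p i)" for i
  \<comment> \<open>The same unit phase on both sides preserves duality, because the form conjugates
    its second argument.\<close>
  define q' where "q' i = scale (t i) (q i)" for i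
  have tt: "t i * cnj (t i) = 1" for i using t[of i] complex_norm_square[of "t i"] by simp
  have dual: "dual_frames q' p'"
    unfolding dual_frames_def q'_def p'_def by (auto simp: form_scale_left form_scale_right pq tt mult.commute)
  have at: "of_real (a i) * t i = g i" for i using a[of i] by (simp add: t_def)
  have P4': "P 4 = (\<Sum>i\<in>UNIV. scale (of_real (a i)) (p' i))"
    unfolding P4 p'_def by (simp add: at)
  have r1: "rank_one (p' i) = rank_one (p i)" for i
    unfolding p'_def by (rule rank_one_scale[OF t])
  have comb: "equitant_comb p' a s = (\<Sum>i=1..4. rscale (r i) (rank_one (P i)))"
    if "s 1 = r 1" "s 2 = r 2" "s 3 = r 3" "(\<Sum>i=1..4. r i) = 0" for s and r :: "nat \<Rightarrow> real"
  proof -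
    have r4: "r 4 = - (s 1 + s 2 + s 3)" using that(4) unfolding sum_1_to_4 that(1-3) by linarith
    show ?thesis
      unfolding equitant_comb_def P4'[symmetric] r1 sum_1_to_4
      by (simp add: sum_3 r4 p_def that(1-3) fun_eq_iff rscale_apply scale_left_distrib scale_left_diff_distrib
          algebra_simps)
  qed
  have "W = range (equitant_comb p' a)"
  proof (intro equalityI subsetI)
    fix h assume "h \<in> W"
    then obtain r :: "nat \<Rightarrow> real" where "h = (\<Sum>i=1..4. rscale (r i) (rank_one (P i)))" "(\<Sum>i=1..4. r i) = 0"
      unfolding W by blast
    then show "h \<in> range (equitant_comb p' a)"
      using comb[of "vec3 (r 1) (r 2) (r 3)" r] by (metis rangeI vec3_simps)
  next
    fix h assume "h \<in> range (equitant_comb p' a)"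
    then obtain s where s: "h = equitant_comb p' a s" by blast
    define r :: "nat \<Rightarrow> real" where
      "r i = (if i = 1 then s 1 else if i = 2 then s 2 else if i = 3 then s 3 else - (s 1 + s 2 + s 3))" for i
    have r: "s 1 = r 1" "s 2 = r 2" "s 3 = r 3" "(\<Sum>i=1..4. r i) = 0" unfolding sum_1_to_4 by (simp_all add: r_def)
    show "h \<in> W" unfolding W s using comb[OF r] r(4) by blast
  qed
  then show thesis using that dual a by blast
qed

text \<open>In the basis chosen by \<open>irreducible_cubic\<close>, the parameters
  \<open>r i\<close> of \<open>equitant_comb\<close> become linear forms \<open>f i\<close> in
  \<open>x\<close>, \<open>y\<close>, \<open>z\<close>, so the degenerate factorisation applies with
  \<open>A\<close>, \<open>B\<close>, \<open>C\<close> the squares of the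
  \<open>a i\<close>.\<close>

lemma irreducible_cubic_not_degenerate:
  assumes W: "W = range (equitant_comb p a)" and a: "\<And>i. a i > 0" and irr: "irreducible_cubic W"
  shows "\<not> (a 1 = 1 \<and> a 2 = a 3)" "\<not> (a 2 = 1 \<and> a 1 = a 3)" "\<not> (a 3 = 1 \<and> a 1 = a 2)"
proof -
  obtain h1 h2 h3 and F :: "real poly poly poly" where
    span: "lin.span {h1, h2, h3} = W"
    and F: "\<And>x y z. lin_det (rscale x h1 + rscale y h2 + rscale z h3) =
                   complex_of_real (poly (poly (poly F [:[:x:]:]) [:y:]) z)"
    and irrF: "irreducible F"
    using irr unfolding irreducible_cubic_def by blast
  have "h1 \<in> W" "h2 \<in> W" "h3 \<in> W" unfolding span[symmetric] by (auto intro: lin.span_base)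
  then obtain r s t where h: "h1 = equitant_comb p a r" "h2 = equitant_comb p a s" "h3 = equitant_comb p a t"
    unfolding W by blast
  obtain K where K: "\<And>r. lin_det (equitant_comb p a r) =
    K * of_real (r 1 * r 2 * r 3 - (r 1 + r 2 + r 3)
          * ((a 3)\<^sup>2 * r 1 * r 2 + (a 2)\<^sup>2 * r 1 * r 3 + (a 1)\<^sup>2 * r 2 * r 3))"
    using lin_det_equitant_comb by blast
  define f where "f i x y z = r i * x + s i * y + t i * z" for i x y z
  have comb: "rscale x h1 + rscale y h2 + rscale z h3 = equitant_comb p a (\<lambda>i. f i x y z)" for x y z
    unfolding h equitant_comb_linear f_def by (simp add: mult.commute)
  \<comment> \<open>Both \<open>eval3 F\<close> and the cubic are real, so taking real parts
    replaces the complex constant \<open>K\<close> by \<open>Re K\<close>.\<close>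
  have "eval3 F x y z = Re (complex_of_real (eval3 F x y z))" for x y z by simp
  then have F': "eval3 F x y z = Re K * (f 1 x y z * f 2 x y z * f 3 x y z
      - (f 1 x y z + f 2 x y z + f 3 x y z)
        * ((a 3)\<^sup>2 * f 1 x y z * f 2 x y z + (a 2)\<^sup>2 * f 1 x y z * f 3 x y z
           + (a 1)\<^sup>2 * f 2 x y z * f 3 x y z))" for x y z
    unfolding eval3_def F[symmetric] comb K by (simp only: Re_complex_of_real times_complex.sel Im_complex_of_real mult_zero_right diff_0_right)
  have "\<not> ((a 1)\<^sup>2 = 1 \<and> (a 2)\<^sup>2 = (a 3)\<^sup>2 \<or> (a 2)\<^sup>2 = 1 \<and> (a 1)\<^sup>2 = (a 3)\<^sup>2
      \<or> (a 3)\<^sup>2 = 1 \<and> (a 1)\<^sup>2 = (a 2)\<^sup>2)"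
  proof
    assume deg: "(a 1)\<^sup>2 = 1 \<and> (a 2)\<^sup>2 = (a 3)\<^sup>2 \<or> (a 2)\<^sup>2 = 1 \<and> (a 1)\<^sup>2 = (a 3)\<^sup>2
      \<or> (a 3)\<^sup>2 = 1 \<and> (a 1)\<^sup>2 = (a 2)\<^sup>2"
    have "\<exists>l m n. \<forall>x y z. g x y z = l * x + m * y + n * z" if "g \<in> {f 1, f 2, f 3}" for g
      using that unfolding f_def by blast
    then have "\<not> irreducible F" using F' deg by (rule degenerate_cubic_not_irreducible)
    then show False using irrF by blast
  qed
  then show "\<not> (a 1 = 1 \<and> a 2 = a 3)" "\<not> (a 2 = 1 \<and> a 1 = a 3)" "\<not> (a 3 = 1 \<and> a 1 = a 2)"
    by auto
qed

text \<open>As \<open>r\<close> is arbitrary, the base equations say that the three coordinates of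
  \<open>v\<close> and their combination with coefficients \<open>a\<close> all have the same
  modulus; dividing by the first coordinate lands on the torus.\<close>

lemma equitant_comb_base_normalize:
  assumes dual: "dual_frames q p" and v: "v \<noteq> 0"
    and base: "\<And>r. form (equitant_comb p a r v) v = 0"
  obtains u w :: complex where "span {v} = span {q 1 + scale u (q 2) + scale w (q 3)}"
    "cmod u = 1" "cmod w = 1" "cmod (a 1 + a 2 * u + a 3 * w) = 1"
proof -
  define z where "z i = form v (p i)" for i
  define s where "s = (\<Sum>i\<in>UNIV. of_real (a i) * z i)"
  have zs: "cmod (z i) = cmod s" for i
  proof -
    \<comment> \<open>The parameter vector concentrated at \<open>i\<close> isolates the
      \<open>i\<close>-th coordinate in the base equation.\<close>
    have d: "(\<Sum>j\<in>UNIV. of_real (if j = i then 1 else 0) * z j * cnj (z j)) = z i * cnj (z i)"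
      using exhaust_3[of i] by (auto simp: sum_3)
    have "z i * cnj (z i) = s * cnj s"
      using base[of "\<lambda>j. if j = i then 1 else 0"] unfolding form_equitant_comb z_def[symmetric] d s_def by simp
    then have "complex_of_real ((cmod (z i))\<^sup>2) = of_real ((cmod s)\<^sup>2)"
      by (simp only: complex_norm_square)
    then have "(cmod (z i))\<^sup>2 = (cmod s)\<^sup>2" by (simp only: of_real_eq_iff)
    then show ?thesis by (simp add: power2_eq_iff_nonneg)
  qed
  have v_eq: "v = (\<Sum>i\<in>UNIV. scale (z i) (q i))"
    unfolding z_def by (rule dual_frames_expand[OF dual])
  have "s \<noteq> 0"
  proof
    assume "s = 0"
    then have "z i = 0" for i using zs[of i] by simp
    then show False using v v_eq by simp
  qed
  then have z0: "z i \<noteq> 0" for i using zs[of i] by auto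
  show thesis
  proof (rule that)
    let ?w = "q 1 + scale (z 2 / z 1) (q 2) + scale (z 3 / z 1) (q 3)"
    have "v = scale (z 1) ?w"
      unfolding v_eq sum_3 using z0 by (simp add: scale_right_distrib)
    moreover have "span (scale (z 1) ` {?w}) = span {?w}"
      by (rule span_image_scale) (simp_all add: z0)
    ultimately show "span {v} = span {?w}" by (simp only: image_insert image_empty)
    show "cmod (z 2 / z 1) = 1" "cmod (z 3 / z 1) = 1"
      using z0 by (simp_all add: norm_divide zs \<open>s \<noteq> 0\<close>)
    have "a 1 + a 2 * (z 2 / z 1) + a 3 * (z 3 / z 1) = s / z 1"
      unfolding s_def sum_3 using z0 by (simp add: add_divide_distrib)
    then show "cmod (a 1 + a 2 * (z 2 / z 1) + a 3 * (z 3 / z 1)) = 1"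
      using \<open>s \<noteq> 0\<close> by (simp add: norm_divide zs)
  qed
qed

text \<open>The Gram matrix \<open>H\<close> of \<open>h\<close> in the frame \<open>q\<close> has
  its off-diagonal entries and trace fixed by \<open>hermitian_form_multiple\<close>; what remains
  free on the diagonal is exactly the parameter \<open>r\<close> of the family.\<close>

lemma self_adjoint_vanishing_imp_equitant_comb:
  assumes dual: "dual_frames q p" and a: "\<And>i. a i > 0"
    and nex: "\<not> (a 1 = 1 \<and> a 2 = a 3)" "\<not> (a 2 = 1 \<and> a 1 = a 3)" "\<not> (a 3 = 1 \<and> a 1 = a 2)"
    and h: "h \<in> Lin" "adj h = h"
    and B: "B \<subseteq> base (range (equitant_comb p a))" "infinite B"
    and van: "\<And>P v. P \<in> B \<Longrightarrow> v \<in> P \<Longrightarrow> form (h v) v = 0"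
  shows "h \<in> range (equitant_comb p a)"
proof -
  define H where "H i j = form (h (q i)) (q j)" for i j
  have Hc: "cnj (H i j) = H j i" for i j
    unfolding H_def by (metis form_commute form_self_adjoint[OF h])
  have form_h: "form (h x) y = (\<Sum>i\<in>UNIV. \<Sum>j\<in>UNIV. form x (p i) * cnj (form y (p j)) * H i j)" for x y
  proof -
    have "form (h x) y = form (h (\<Sum>i\<in>UNIV. scale (form x (p i)) (q i))) (\<Sum>j\<in>UNIV. scale (form y (p j)) (q j))"
      using dual_frames_expand[OF dual] by metis
    then show ?thesis
      by (simp add: Lin_add[OF h(1)] Lin_scale[OF h(1)] form_add_left form_add_right
          form_scale_left form_scale_right H_def sum_3 algebra_simps)
  qed
  define point where "point = (\<lambda>(u, w). span {q 1 + scale u (q 2) + scale w (q 3)})"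
  define Z :: "(complex \<times> complex) set"
    where "Z = {(u, w). point (u, w) \<in> B \<and> cmod u = 1 \<and> cmod w = 1 \<and> cmod (a 1 + a 2 * u + a 3 * w) = 1}"
  \<comment> \<open>Every point of \<open>B\<close> has a normalised torus representative, so
    infinitely many points need infinitely many pairs in \<open>Z\<close>.\<close>
  have "B \<subseteq> point ` Z"
  proof
    fix P assume P: "P \<in> B"
    then obtain v where v: "P = span {v}" "v \<noteq> 0" using B(1) by (auto simp: base_def points_def)
    have "v \<in> P" unfolding v(1) by (simp add: span_base)
    then have "form (equitant_comb p a r v) v = 0" for r using B(1) P by (auto simp: base_def)
    then obtain u w :: complex where "span {v} = span {q 1 + scale u (q 2) + scale w (q 3)}"
      "cmod u = 1" "cmod w = 1" "cmod (a 1 + a 2 * u + a 3 * w) = 1"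
      by (rule equitant_comb_base_normalize[OF dual v(2)])
    then show "P \<in> point ` Z" using P v(1) by (intro image_eqI[of _ _ "(u, w)"]) (auto simp: Z_def point_def)
  qed
  then have inf: "infinite Z" using B(2) finite_surj by blast
  have Z1: "(a 1 + a 2 * u + a 3 * w) * (a 1 * u * w + a 2 * w + a 3 * u) = u * w"
    and Z2: "(H 1 1 + H 2 2 + H 3 3) * u * w + cnj (H 1 2) * u\<^sup>2 * w + H 1 2 * w
       + cnj (H 1 3) * u * w\<^sup>2 + H 1 3 * u + H 2 3 * u\<^sup>2 + cnj (H 2 3) * w\<^sup>2 = 0"
    if uw: "(u, w) \<in> Z" for u w :: complex
  proof -
    define A where "A = a 1 + a 2 * u + a 3 * w"
    have u: "u * cnj u = 1" and w: "w * cnj w = 1"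
      and s: "A * cnj A = 1"
      using uw complex_norm_square[of u] complex_norm_square[of w] complex_norm_square[of A]
      by (simp_all add: Z_def A_def)
    \<comment> \<open>On the torus the conjugates are inverses, so multiplying \<open>cnj A\<close>
      by \<open>u * w\<close> turns it into a polynomial.\<close>
    have "a 1 * u * w + a 2 * w * (u * cnj u) + a 3 * u * (w * cnj w) = u * w * cnj A"
      by (simp add: A_def algebra_simps)
    then have "A * (a 1 * u * w + a 2 * w + a 3 * u) = A * (u * w * cnj A)"
      by (simp only: u w mult_1_right)
    also have "\<dots> = u * w * (A * cnj A)" by (simp only: mult_ac)
    finally show "(a 1 + a 2 * u + a 3 * w) * (a 1 * u * w + a 2 * w + a 3 * u) = u * w"
      unfolding s mult_1_right unfolding A_def .
    let ?v = "q 1 + scale u (q 2) + scale w (q 3)"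
    have "point (u, w) \<in> B" "?v \<in> point (u, w)" using uw by (auto simp: Z_def point_def span_base)
    then have "form (h ?v) ?v = 0" by (rule van)
    moreover have "form ?v (p 1) = 1" "form ?v (p 2) = u" "form ?v (p 3) = w"
      using dual by (simp_all add: form_add_left form_scale_left dual_frames_def)
    ultimately have "(\<Sum>i\<in>UNIV. \<Sum>j\<in>UNIV. vec3 1 u w i * cnj (vec3 1 u w j) * H i j) = 0"
      by (simp add: form_h sum_3)
    \<comment> \<open>The same multiplication clears the conjugates from the hermitian form.\<close>
    then have "u * w * (\<Sum>i\<in>UNIV. \<Sum>j\<in>UNIV. vec3 1 u w i * cnj (vec3 1 u w j) * H i j) = 0"
      by simp
    also have "u * w * (\<Sum>i\<in>UNIV. \<Sum>j\<in>UNIV. vec3 1 u w i * cnj (vec3 1 u w j) * H i j)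
      = H 1 1 * u * w + H 2 2 * u * w * (u * cnj u) + H 3 3 * u * w * (w * cnj w) + cnj (H 1 2) * u\<^sup>2 * w
       + H 1 2 * w * (u * cnj u) + cnj (H 1 3) * u * w\<^sup>2 + H 1 3 * u * (w * cnj w)
       + H 2 3 * u\<^sup>2 * (w * cnj w) + cnj (H 2 3) * w\<^sup>2 * (u * cnj u)"
      by (simp add: sum_3 Hc power2_eq_square algebra_simps)
    finally show "(H 1 1 + H 2 2 + H 3 3) * u * w + cnj (H 1 2) * u\<^sup>2 * w + H 1 2 * w
       + cnj (H 1 3) * u * w\<^sup>2 + H 1 3 * u + H 2 3 * u\<^sup>2 + cnj (H 2 3) * w\<^sup>2 = 0"
      unfolding u w by (simp add: algebra_simps)
  qed
  obtain k :: real where k: "H 1 2 = k * a 1 * a 2" "H 1 3 = k * a 1 * a 3" "H 2 3 = k * a 2 * a 3"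
    and d: "H 1 1 + H 2 2 + H 3 3 = k * ((a 1)\<^sup>2 + (a 2)\<^sup>2 + (a 3)\<^sup>2 - 1)"
    using hermitian_form_multiple[OF a a a nex inf Z1 Z2] by blast
  have k': "H 2 1 = k * a 1 * a 2" "H 3 1 = k * a 1 * a 3" "H 3 2 = k * a 2 * a 3"
    unfolding Hc[symmetric, of 2 1] Hc[symmetric, of 3 1] Hc[symmetric, of 3 2] k by simp_all
  \<comment> \<open>Chosen so that \<open>H\<close> becomes the diagonal matrix of \<open>r\<close>
    plus \<open>k\<close> times the rank-one matrix \<open>a i * a j\<close>.\<close>
  define r where "r i = Re (H i i) - k * (a i)\<^sup>2" for i
  have Hr: "H i i = of_real (r i + k * (a i)\<^sup>2)" for i
    using Hc[of i i] by (simp add: r_def complex_eq_iff)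
  \<comment> \<open>The trace equation makes \<open>- k\<close> the sum of the \<open>r i\<close>,
    which is the coefficient that \<open>equitant_comb\<close> prescribes for the rank-one
    term.\<close>
  have "complex_of_real (r 1 + r 2 + r 3 + k) = 0"
    using d unfolding Hr by (simp add: algebra_simps)
  then have "r 1 + r 2 + r 3 + k = 0" by (simp only: of_real_eq_0_iff)
  then have kr: "(\<Sum>i\<in>UNIV. r i) = - k" by (simp add: sum_3)
  have "h = equitant_comb p a r"
  proof
    fix x
    show "h x = equitant_comb p a r x"
    proof (rule form_eqI)
      fix y
      show "form (h x) y = form (equitant_comb p a r x) y"
        unfolding form_h form_equitant_comb kr
        by (simp add: sum_3 k k' Hr power2_eq_square algebra_simps)
    qed
  qed
  then show ?thesis by blast
qed

lemma equitant_family_determined_by_base_points: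
  assumes W: "equitant_family W" and irr: "irreducible_cubic W" and B: "B \<subseteq> base W" "infinite B"
  shows "W = {h \<in> Lin. adj h = h \<and> (\<forall>P\<in>B. \<forall>b\<in>P. form (h b) b = 0)}"
proof (intro equalityI subsetI)
  fix h assume "h \<in> W"
  moreover from W have "W \<subseteq> Lin" "\<forall>h\<in>W. adj h = h"
    by (auto simp: equitant_family_def elliptic_family_def bisector_family_def)
  ultimately show "h \<in> {h \<in> Lin. adj h = h \<and> (\<forall>P\<in>B. \<forall>b\<in>P. form (h b) b = 0)}"
    using B(1) by (auto simp: base_def)
next
  fix h assume h: "h \<in> {h \<in> Lin. adj h = h \<and> (\<forall>P\<in>B. \<forall>b\<in>P. form (h b) b = 0)}"
  obtain q p a where dual: "dual_frames q p" and a: "\<And>i. a i > 0" and WE: "W = range (equitant_comb p a)"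
    by (rule equitant_normal_form[OF W]) blast
  show "h \<in> W"
    unfolding WE
    by (rule self_adjoint_vanishing_imp_equitant_comb
        [OF dual a irreducible_cubic_not_degenerate[OF WE a irr], of h B])
      (use h B WE in auto)
qed

end

theorem theorem1p2p11:
  fixes scale :: "complex \<Rightarrow> 'v::ab_group_add \<Rightarrow> 'v"
    and form :: "'v \<Rightarrow> 'v \<Rightarrow> complex"
    and W :: "('v \<Rightarrow> 'v) set"
    and B :: "'v set set"
  assumes "hermitian_space scale form"
    and "hermitian_space.equitant_family scale form W"
    and "hermitian_space.irreducible_cubic scale W"
    and "B \<subseteq> hermitian_space.base scale form W"
    and "infinite B"
  shows "W = {h \<in> hermitian_space.Lin scale.
                hermitian_space.adj scale form h = h \<and> (\<forall>P\<in>B. \<forall>b\<in>P. form (h b) b = 0)}"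
  by (rule hermitian_space.equitant_family_determined_by_base_points[OF assms])

end
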